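(* Let $p,q\ge 0$ be integers with $n=p+q\ge 1$. The subspaces $$\overline{\mathbf 2},\qquad \overline{\mathbf 2}\oplus i\,\overline{\mathbf 0},\qquad \overline{\mathbf 2}\oplus i\,\overline{\mathbf 1},\qquad \overline{\mathbf{23}}$$ of the complex Clifford algebra $\mathcal{C}\!\ell^{\mathbb C}(p,q)$ are closed with respect to the operation $U,V\mapsto[U,V]=UV-VU$ and form subalgebras of the Lie algebra $w\mathcal{C}\!\ell^{\mathbb C}(p,q)=\{u\in\mathcal{C}\!\ell^{\mathbb C}(p,q):u^*=-u\}$ of the pseudo-unitary group $W\mathcal{C}\!\ell^{\mathbb C}(p,q)=\{U\in\mathcal{C}\!\ell^{\mathbb C}(p,q):U^*U=e\}$ of the Clifford algebra.
   Context: $\mathcal{C}\!\ell^{\mathbb F}(p,q)$ ($\mathbb F=\mathbb R$ or $\mathbb C$) is the Clifford algebra over $\mathbb F$ with identity $e$ and generators $e^1,\dots,e^n$, $n=p+q$, satisfying $e^ae^b+e^be^a=2\eta^{ab}e$, where $\eta$ is diagonal with $p$ entries $+1$ followed by $q$ entries $-1$. The $2^n$ elements $e$ and $e^{a_1\ldots a_k}=e^{a_1}\cdots e^{a_k}$ ($a_1<\dots<a_k$, $1\le k\le n$) form an $\mathbb F$-basis. $\mathcal{C}\!\ell^{\mathbb F}_k(p,q)$ is the $\mathbb F$-span of the basis elements with $k$ indices (rank $k$; $k=0$ means the span of $e$), and it is zero for $k>n$. We regard $\mathcal{C}\!\ell^{\mathbb R}(p,q)\subset\mathcal{C}\!\ell^{\mathbb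 C}(p,q)=\mathcal{C}\!\ell^{\mathbb R}(p,q)\oplus i\,\mathcal{C}\!\ell^{\mathbb R}(p,q)$. For $k\in\{0,1,2,3\}$, $\overline{\mathbf k}=\bigoplus_{j\equiv k \,(\mathrm{mod}\,4)}\mathcal{C}\!\ell^{\mathbb R}_j(p,q)$, and $\overline{\mathbf{kl}}=\overline{\mathbf k}\oplus\overline{\mathbf l}$. All these are real vector spaces, and $w\mathcal{C}\!\ell^{\mathbb C}(p,q)$ is a real Lie algebra under the commutator. Clifford conjugation $*$ on $\mathcal{C}\!\ell^{\mathbb C}(p,q)$ is the additive map with $e^*=e$ and $(\lambda\, e^{a_1}e^{a_2}\cdots e^{a_k})^*=\overline\lambda\, e^{a_k}\cdots e^{a_1}$ for $\lambda\in\mathbb C$; in particular $(e^a)^*=e^a$. *)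

theory Defs
  imports Complex_Main "HOL-Algebra.Group"
begin

section \<open>The underlying vector space\<close>

text \<open>
  The coefficient at a finite set \<open>A\<close> is the coordinate with respect to the basis element that is
  the product, in increasing order, of the generators with indices in \<open>A\<close>.  The type is larger than any single Clifford algebra, so that
  \<open>p\<close> and \<open>q\<close> can be ordinary variables; the algebra itself is the carrier \<open>Cl p q\<close> below.
\<close>

typedef multivector = "UNIV :: (nat set \<Rightarrow> complex) set"
  morphisms coeff multivector_of
  by simp

setup_lifting type_definition_multivector

lemma multivector_eqI: "(\<And>A. coeff u A = coeff v A) \<Longrightarrow> u = v"
  by transfer auto

instantiation multivector :: real_vector
begin

lift_definition zero_multivector :: multivector is "\<lambda>_. 0" .
lift_definition plus_multivector :: "multivector \<Rightarrow> multivector \<Rightarrow> multivector"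
  is "\<lambda>u v A. u A + v A" .
lift_definition minus_multivector :: "multivector \<Rightarrow> multivector \<Rightarrow> multivector"
  is "\<lambda>u v A. u A - v A" .
lift_definition uminus_multivector :: "multivector \<Rightarrow> multivector" is "\<lambda>u A. - u A" .
lift_definition scaleR_multivector :: "real \<Rightarrow> multivector \<Rightarrow> multivector"
  is "\<lambda>r u A. r *\<^sub>R u A" .

instance
  by standard (transfer, simp add: fun_eq_iff algebra_simps)+

end

lift_definition scaleC :: "complex \<Rightarrow> multivector \<Rightarrow> multivector"  (infixr "*\<^sub>C" 75)
  is "\<lambda>c u A. c * u A" .

lift_definition blade :: "nat set \<Rightarrow> multivector" is "\<lambda>A B. if A = B then 1 else 0" .

lemmas coeff_simps [simp] =
  zero_multivector.rep_eq plus_multivector.rep_eq minus_multivector.rep_eq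
  uminus_multivector.rep_eq scaleR_multivector.rep_eq scaleC.rep_eq blade.rep_eq

lemma coeff_sum [simp]: "coeff (sum f S) A = (\<Sum>x\<in>S. coeff (f x) A)"
  by (induction S rule: infinite_finite_induct) auto


section \<open>The Clifford algebra\<close>

definition Cl :: "nat \<Rightarrow> nat \<Rightarrow> multivector set" where
  "Cl p q = {u. \<forall>A. coeff u A \<noteq> 0 \<longrightarrow> A \<subseteq> {1..p + q}}"

definition cl_eta :: "nat \<Rightarrow> nat \<Rightarrow> complex" where
  "cl_eta p a = (if a \<le> p then 1 else - 1)"

text \<open>
  Sorting the product of the basis elements belonging to \<open>A\<close> and \<open>B\<close> costs a factor \<open>-1\<close> for every
  inversion, and every repeated generator contributes its square.  That this gives an associative
  unital algebra in which the generators satisfy the Clifford relations, and in which \<open>blade A\<close> is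
  the ordered product of the generators with indices in \<open>A\<close>, is proved below.
\<close>

definition cl_sign :: "nat \<Rightarrow> nat set \<Rightarrow> nat set \<Rightarrow> complex" where
  "cl_sign p A B =
     (- 1) ^ card {(a, b). a \<in> A \<and> b \<in> B \<and> b < a} * (\<Prod>a\<in>A \<inter> B. cl_eta p a)"

definition cl_mult :: "nat \<Rightarrow> nat \<Rightarrow> multivector \<Rightarrow> multivector \<Rightarrow> multivector" where
  "cl_mult p q u v =
     (\<Sum>A\<in>Pow {1..p + q}. \<Sum>B\<in>Pow {1..p + q}.
        (coeff u A * coeff v B * cl_sign p A B) *\<^sub>C blade (sym_diff A B))"

definition cl_one :: multivector where
  "cl_one = blade {}"

definition cl_gen :: "nat \<Rightarrow> multivector" where
  "cl_gen a = blade {a}"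

definition cl_word :: "nat \<Rightarrow> nat \<Rightarrow> nat list \<Rightarrow> multivector" where
  "cl_word p q as = foldr (\<lambda>a. cl_mult p q (cl_gen a)) as cl_one"

definition cl_comm :: "nat \<Rightarrow> nat \<Rightarrow> multivector \<Rightarrow> multivector \<Rightarrow> multivector" where
  "cl_comm p q u v = cl_mult p q u v - cl_mult p q v u"

text \<open>
  Clifford conjugation.  It is determined by its values on the multiples of the basis elements:
  the order of the generators is reversed and the coefficient is conjugated.
\<close>

definition cl_star :: "nat \<Rightarrow> nat \<Rightarrow> multivector \<Rightarrow> multivector" where
  "cl_star p q u =
     (\<Sum>A\<in>Pow {1..p + q}. cnj (coeff u A) *\<^sub>C cl_word p q (rev (sorted_list_of_set A)))"


section \<open>Subspaces of real elements\<close>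

definition cl_rank :: "nat \<Rightarrow> nat \<Rightarrow> nat \<Rightarrow> multivector set" where
  "cl_rank p q k = span (blade ` {A. A \<subseteq> {1..p + q} \<and> card A = k})"

text \<open>
  The sum of the family of subspaces of ranks congruent to \<open>k\<close>, as the real span of their union.
\<close>

definition cl_qtype :: "nat \<Rightarrow> nat \<Rightarrow> nat \<Rightarrow> multivector set" where
  "cl_qtype p q k = span (\<Union>j\<in>{j. j mod 4 = k mod 4}. cl_rank p q j)"

definition subspace_sum :: "multivector set \<Rightarrow> multivector set \<Rightarrow> multivector set"
    (infixl "\<oplus>\<^sub>S" 65) where
  "S \<oplus>\<^sub>S T = {u + v | u v. u \<in> S \<and> v \<in> T}"

definition times_i :: "multivector set \<Rightarrow> multivector set" where
  "times_i S = (\<lambda>u. \<i> *\<^sub>C u) ` S"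


section \<open>Lie algebras and the pseudo-unitary group\<close>

definition real_lie_algebra :: "nat \<Rightarrow> nat \<Rightarrow> multivector set \<Rightarrow> bool" where
  "real_lie_algebra p q L \<longleftrightarrow>
     L \<subseteq> Cl p q \<and> subspace L \<and> (\<forall>u\<in>L. \<forall>v\<in>L. cl_comm p q u v \<in> L)"

definition lie_subalgebra :: "nat \<Rightarrow> nat \<Rightarrow> multivector set \<Rightarrow> multivector set \<Rightarrow> bool" where
  "lie_subalgebra p q L M \<longleftrightarrow>
     real_lie_algebra p q L \<and> real_lie_algebra p q M \<and> L \<subseteq> M"

definition wCl :: "nat \<Rightarrow> nat \<Rightarrow> multivector set" where
  "wCl p q = {u \<in> Cl p q. cl_star p q u = - u}"

definition WCl :: "nat \<Rightarrow> nat \<Rightarrow> multivector monoid" where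
  "WCl p q =
     \<lparr>carrier = {U \<in> Cl p q. cl_mult p q (cl_star p q U) U = cl_one},
      monoid.mult = cl_mult p q, one = cl_one\<rparr>"

primrec cl_power :: "nat \<Rightarrow> nat \<Rightarrow> multivector \<Rightarrow> nat \<Rightarrow> multivector" where
  "cl_power p q u 0 = cl_one"
| "cl_power p q u (Suc k) = cl_mult p q u (cl_power p q u k)"

text \<open>
  The algebra is finite-dimensional, so the exponential series converges in norm exactly if it
  converges in every coordinate.
\<close>

definition cl_exp :: "nat \<Rightarrow> nat \<Rightarrow> multivector \<Rightarrow> multivector" where
  "cl_exp p q u = multivector_of (\<lambda>A. \<Sum>k. coeff (cl_power p q u k) A / fact k)"

text \<open>
  The Lie algebra of a closed linear group, as the set of generators of its one-parameter subgroups.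
\<close>

definition lie_algebra_of :: "nat \<Rightarrow> nat \<Rightarrow> multivector monoid \<Rightarrow> multivector set" where
  "lie_algebra_of p q G = {u \<in> Cl p q. \<forall>t::real. cl_exp p q (t *\<^sub>R u) \<in> carrier G}"


section \<open>The multiplication is the Clifford multiplication\<close>

lemma scaleC_simps [simp]:
  "c *\<^sub>C (d *\<^sub>C u) = (c * d) *\<^sub>C u" "1 *\<^sub>C u = u" "0 *\<^sub>C u = 0" "c *\<^sub>C 0 = 0"
  by (auto intro!: multivector_eqI)

lemma scaleC_add: "c *\<^sub>C (u + v) = c *\<^sub>C u + c *\<^sub>C v" "(c + d) *\<^sub>C u = c *\<^sub>C u + d *\<^sub>C u"
  by (auto intro!: multivector_eqI simp: algebra_simps)

lemma scaleC_sum: "c *\<^sub>C sum f S = (\<Sum>x\<in>S. c *\<^sub>C f x)"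
  by (auto intro!: multivector_eqI simp: sum_distrib_left)

lemma cl_mult_add_left: "cl_mult p q (u + v) w = cl_mult p q u w + cl_mult p q v w"
  by (simp add: cl_mult_def algebra_simps scaleC_add sum.distrib)

lemma cl_mult_add_right: "cl_mult p q w (u + v) = cl_mult p q w u + cl_mult p q w v"
  by (simp add: cl_mult_def algebra_simps scaleC_add sum.distrib)

lemma cl_mult_scale_left: "cl_mult p q (c *\<^sub>C u) w = c *\<^sub>C cl_mult p q u w"
  by (simp add: cl_mult_def scaleC_sum mult.assoc)

lemma cl_mult_scale_right: "cl_mult p q w (c *\<^sub>C u) = c *\<^sub>C cl_mult p q w u"
  by (simp add: cl_mult_def scaleC_sum ac_simps)

lemma cl_mult_zero [simp]: "cl_mult p q 0 w = 0" "cl_mult p q w 0 = 0"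
  by (simp_all add: cl_mult_def)

lemma cl_mult_sum_left: "cl_mult p q (sum f S) w = (\<Sum>x\<in>S. cl_mult p q (f x) w)"
  by (induction S rule: infinite_finite_induct) (auto simp: cl_mult_add_left)

lemma cl_mult_sum_right: "cl_mult p q w (sum f S) = (\<Sum>x\<in>S. cl_mult p q w (f x))"
  by (induction S rule: infinite_finite_induct) (auto simp: cl_mult_add_right)

lemma cl_mult_blade:
  assumes "A \<subseteq> {1..p + q}" "B \<subseteq> {1..p + q}"
  shows "cl_mult p q (blade A) (blade B) = cl_sign p A B *\<^sub>C blade (sym_diff A B)"
proof -
  have "cl_mult p q (blade A) (blade B) =
     (\<Sum>X\<in>Pow {1..p + q}. \<Sum>Y\<in>Pow {1..p + q}.
       if A = X then if B = Y then cl_sign p X Y *\<^sub>C blade (sym_diff X Y) else 0 else 0)"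
    unfolding cl_mult_def by (intro sum.cong refl) simp
  also have "\<dots> = (\<Sum>X\<in>Pow {1..p + q}. if A = X then \<Sum>Y\<in>Pow {1..p + q}.
       if B = Y then cl_sign p X Y *\<^sub>C blade (sym_diff X Y) else 0 else 0)"
    by (intro sum.cong refl) simp
  also have "\<dots> = cl_sign p A B *\<^sub>C blade (sym_diff A B)"
    using assms by simp
  finally show ?thesis .
qed

lemma Cl_expand:
  assumes "u \<in> Cl p q"
  shows "u = (\<Sum>A\<in>Pow {1..p + q}. coeff u A *\<^sub>C blade A)"
proof (rule multivector_eqI)
  fix B
  show "coeff u B = coeff (\<Sum>A\<in>Pow {1..p + q}. coeff u A *\<^sub>C blade A) B"
    using assms by (auto simp: Cl_def if_distrib cong: if_cong)
qed

lemma cl_sign_prod: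
  assumes "A \<subseteq> {1..n}" "B \<subseteq> {1..n}"
  shows "cl_sign p A B =
    (\<Prod>i\<in>{1..n}. \<Prod>j\<in>{1..n}. if i \<in> A \<and> j \<in> B \<and> j < i then - 1 else 1) *
    (\<Prod>i\<in>{1..n}. if i \<in> A \<and> i \<in> B then cl_eta p i else 1)"
proof -
  have eq: "{(a, b). a \<in> A \<and> b \<in> B \<and> b < a} =
      ({1..n} \<times> {1..n}) \<inter> {x. fst x \<in> A \<and> snd x \<in> B \<and> snd x < fst x}"
    using assms by auto
  have "(\<Prod>i\<in>{1..n}. \<Prod>j\<in>{1..n}. if i \<in> A \<and> j \<in> B \<and> j < i then - 1 else 1 :: complex) =
      (\<Prod>x\<in>{1..n} \<times> {1..n}. if fst x \<in> A \<and> snd x \<in> B \<and> snd x < fst x then - 1 else 1)"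
    by (simp add: prod.cartesian_product case_prod_unfold)
  also have "\<dots> = (\<Prod>x\<in>{(a, b). a \<in> A \<and> b \<in> B \<and> b < a}. - 1)"
    unfolding eq by (subst prod.inter_restrict) auto
  also have "\<dots> = (- 1) ^ card {(a, b). a \<in> A \<and> b \<in> B \<and> b < a}"
    by simp
  finally have 1: "(\<Prod>i\<in>{1..n}. \<Prod>j\<in>{1..n}. if i \<in> A \<and> j \<in> B \<and> j < i then - 1 else 1) =
    (- 1 :: complex) ^ card {(a, b). a \<in> A \<and> b \<in> B \<and> b < a}" .
  have "A \<inter> B = {1..n} \<inter> {i. i \<in> A \<and> i \<in> B}"
    using assms by auto
  then have 2: "(\<Prod>i\<in>A \<inter> B. cl_eta p i) =
      (\<Prod>i\<in>{1..n}. if i \<in> A \<and> i \<in> B then cl_eta p i else 1)"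
    by (simp add: prod.inter_restrict)
  show ?thesis
    by (simp only: cl_sign_def 1 2)
qed

lemma cl_sign_cocycle:
  assumes "A \<subseteq> {1..n}" "B \<subseteq> {1..n}" "C \<subseteq> {1..n}"
  shows "cl_sign p A B * cl_sign p (sym_diff A B) C =
         cl_sign p B C * cl_sign p A (sym_diff B C)"
proof -
  have AB: "sym_diff A B \<subseteq> {1..n}" and BC: "sym_diff B C \<subseteq> {1..n}"
    using assms by auto
  let ?f = "\<lambda>A B i j. if i \<in> A \<and> j \<in> B \<and> j < i then - 1 else 1 :: complex"
  let ?g = "\<lambda>A B i. if i \<in> A \<and> i \<in> B then cl_eta p i else 1"
  let ?F = "\<lambda>A B. \<Prod>i\<in>{1..n}. \<Prod>j\<in>{1..n}. ?f A B i j"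
  let ?G = "\<lambda>A B. \<Prod>i\<in>{1..n}. ?g A B i"
  have F: "?F A B * ?F (sym_diff A B) C = ?F B C * ?F A (sym_diff B C)"
    unfolding prod.distrib [symmetric] by (intro prod.cong refl) auto
  have G: "?G A B * ?G (sym_diff A B) C = ?G B C * ?G A (sym_diff B C)"
    unfolding prod.distrib [symmetric] by (intro prod.cong refl) auto
  have "cl_sign p A B * cl_sign p (sym_diff A B) C =
      (?F A B * ?F (sym_diff A B) C) * (?G A B * ?G (sym_diff A B) C)"
    by (simp only: cl_sign_prod [OF assms(1,2)] cl_sign_prod [OF AB assms(3)] ac_simps)
  also have "\<dots> = (?F B C * ?F A (sym_diff B C)) * (?G B C * ?G A (sym_diff B C))"
    by (simp only: F G)
  also have "\<dots> = cl_sign p B C * cl_sign p A (sym_diff B C)"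
    by (simp only: cl_sign_prod [OF assms(2,3)] cl_sign_prod [OF assms(1) BC] ac_simps)
  finally show ?thesis .
qed

lemma Cl_blade: "A \<subseteq> {1..p + q} \<Longrightarrow> blade A \<in> Cl p q"
  by (auto simp: Cl_def)

lemma Cl_scaleC: "u \<in> Cl p q \<Longrightarrow> c *\<^sub>C u \<in> Cl p q"
  by (auto simp: Cl_def)

lemma Cl_add: "u \<in> Cl p q \<Longrightarrow> v \<in> Cl p q \<Longrightarrow> u + v \<in> Cl p q"
  unfolding Cl_def mem_Collect_eq coeff_simps by (metis add_0)

lemma Cl_zero: "0 \<in> Cl p q"
  by (auto simp: Cl_def)

lemma Cl_sum: "(\<And>x. x \<in> S \<Longrightarrow> f x \<in> Cl p q) \<Longrightarrow> sum f S \<in> Cl p q"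
  by (induction S rule: infinite_finite_induct) (auto simp: Cl_zero Cl_add)

lemma Cl_mult: "cl_mult p q u v \<in> Cl p q"
  unfolding cl_mult_def by (intro Cl_sum Cl_scaleC Cl_blade) auto

lemma cl_mult_assoc_blade:
  assumes "A \<subseteq> {1..p + q}" "B \<subseteq> {1..p + q}" "C \<subseteq> {1..p + q}"
  shows "cl_mult p q (cl_mult p q (blade A) (blade B)) (blade C) =
         cl_mult p q (blade A) (cl_mult p q (blade B) (blade C))"
proof -
  have sub: "sym_diff A B \<subseteq> {1..p + q}" "sym_diff B C \<subseteq> {1..p + q}"
    using assms by auto
  have eq: "sym_diff (sym_diff A B) C = sym_diff A (sym_diff B C)"
    by auto
  show ?thesis
    by (simp only: cl_mult_blade [OF assms(1,2)] cl_mult_blade [OF assms(2,3)]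
        cl_mult_scale_left cl_mult_scale_right cl_mult_blade [OF sub(1) assms(3)]
        cl_mult_blade [OF assms(1) sub(2)] scaleC_simps eq cl_sign_cocycle [OF assms])
qed

theorem cl_mult_assoc:
  assumes "u \<in> Cl p q" "v \<in> Cl p q" "w \<in> Cl p q"
  shows "cl_mult p q (cl_mult p q u v) w = cl_mult p q u (cl_mult p q v w)"
proof -
  let ?P = "Pow {1..p + q}"
  have step1: "cl_mult p q (cl_mult p q (blade A) (blade B)) w =
        cl_mult p q (blade A) (cl_mult p q (blade B) w)" if "A \<in> ?P" "B \<in> ?P" for A B
    apply (subst (1 2) Cl_expand [OF assms(3)])
    using that by (simp add: cl_mult_sum_right cl_mult_scale_right cl_mult_assoc_blade)
  have step2: "cl_mult p q (cl_mult p q (blade A) v) w =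
        cl_mult p q (blade A) (cl_mult p q v w)" if "A \<in> ?P" for A
    apply (subst (1 2) Cl_expand [OF assms(2)])
    using that step1 by (simp add: cl_mult_sum_right cl_mult_scale_right
        cl_mult_sum_left cl_mult_scale_left)
  show ?thesis
    apply (subst (1 2) Cl_expand [OF assms(1)])
    using step2 by (simp add: cl_mult_sum_left cl_mult_scale_left)
qed

theorem cl_mult_one:
  assumes "u \<in> Cl p q"
  shows "cl_mult p q cl_one u = u" "cl_mult p q u cl_one = u"
proof -
  have "cl_mult p q cl_one u = (\<Sum>A\<in>Pow {1..p + q}. coeff u A *\<^sub>C blade A)"
    unfolding cl_one_def
    by (subst Cl_expand [OF assms])
       (simp add: cl_mult_sum_right cl_mult_scale_right cl_mult_blade cl_sign_def)
  then show "cl_mult p q cl_one u = u"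
    using Cl_expand [OF assms] by simp
  have "cl_mult p q u cl_one = (\<Sum>A\<in>Pow {1..p + q}. coeff u A *\<^sub>C blade A)"
    unfolding cl_one_def
    by (subst Cl_expand [OF assms])
       (simp add: cl_mult_sum_left cl_mult_scale_left cl_mult_blade cl_sign_def)
  then show "cl_mult p q u cl_one = u"
    using Cl_expand [OF assms] by simp
qed

theorem cl_gen_relations:
  assumes "a \<in> {1..p + q}" "b \<in> {1..p + q}"
  shows "cl_mult p q (cl_gen a) (cl_gen b) + cl_mult p q (cl_gen b) (cl_gen a) =
    (2 * (if a = b then if a \<le> p then 1 else - 1 else 0)) *\<^sub>C cl_one"
proof -
  have inv: "{(x, y). x = a \<and> y = b \<and> y < x} = (if b < a then {(a, b)} else {})" for a b :: nat
    by auto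
  have sign: "cl_sign p {a} {b} = (if b < a then - 1 else 1) * (if a = b then cl_eta p a else 1)"
    for a b
    unfolding cl_sign_def using inv [of a b] by auto
  show ?thesis
  proof (cases "a = b")
    case True
    with assms show ?thesis
      by (simp add: cl_gen_def cl_one_def cl_mult_blade sign cl_eta_def scaleC_add(2) [symmetric])
  next
    case False
    have "sym_diff {b} {a} = {a, b}" "sym_diff {a} {b} = {a, b}"
      using False by auto
    with assms False show ?thesis
      by (auto simp: cl_gen_def cl_mult_blade sign scaleC_add(2) [symmetric])
  qed
qed

lemma cl_word_sorted:
  assumes "sorted_wrt (<) as" "set as \<subseteq> {1..p + q}"
  shows "cl_word p q as = blade (set as)"
  using assms
proof (induction "as")
  case Nil
  then show ?case by (simp add: cl_word_def cl_one_def)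
next
  case (Cons a "as")
  have "{(x, y). x \<in> {a} \<and> y \<in> set as \<and> y < x} = {}" and "{a} \<inter> set as = {}"
    using Cons.prems by auto
  then have sign: "cl_sign p {a} (set as) = 1"
    by (simp only: cl_sign_def card.empty prod.empty power_0 mult_1)
  have "cl_word p q (a # as) = cl_mult p q (blade {a}) (blade (set as))"
    using Cons by (simp add: cl_word_def cl_gen_def)
  also have "\<dots> = blade (sym_diff {a} (set as))"
    using Cons.prems by (subst cl_mult_blade) (auto simp: sign)
  also have "sym_diff {a} (set as) = set (a # as)"
    using Cons.prems by auto
  finally show ?case .
qed

theorem blade_eq_ordered_product:
  assumes "A \<subseteq> {1..p + q}"
  shows "blade A = cl_word p q (sorted_list_of_set A)"
proof -
  have "finite A"
    using assms finite_subset by blast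
  with assms show ?thesis
    by (simp add: cl_word_sorted)
qed


section \<open>The sums of subspaces are direct\<close>

lemma cl_qtype_iff:
  "u \<in> cl_qtype p q k \<longleftrightarrow>
    (\<forall>A. coeff u A \<in> \<real> \<and> (coeff u A \<noteq> 0 \<longrightarrow> A \<subseteq> {1..p + q} \<and> card A mod 4 = k mod 4))"
  (is "_ \<longleftrightarrow> ?R u")
proof
  have sub: "subspace (Collect ?R)"
  proof (rule subspaceI)
    fix u v assume "u \<in> Collect ?R" "v \<in> Collect ?R"
    then show "u + v \<in> Collect ?R"
      unfolding mem_Collect_eq coeff_simps by (metis Reals_add add_0)
  next
    fix c u assume "u \<in> Collect ?R"
    then show "c *\<^sub>R u \<in> Collect ?R"
      by (auto simp: scaleR_conv_of_real)
  qed simp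
  have "cl_rank p q j \<subseteq> Collect ?R" if "j mod 4 = k mod 4" for j
    unfolding cl_rank_def using that by (intro span_minimal sub) (auto split: if_splits)
  then have "cl_qtype p q k \<subseteq> Collect ?R"
    unfolding cl_qtype_def by (intro span_minimal sub) blast
  then show "u \<in> cl_qtype p q k \<Longrightarrow> ?R u"
    by blast
next
  assume R: "?R u"
  then have "u \<in> Cl p q"
    by (auto simp: Cl_def)
  have "coeff u A *\<^sub>C blade A \<in> cl_qtype p q k" if "A \<subseteq> {1..p + q}" for A
  proof (cases "coeff u A = 0")
    case True
    then show ?thesis
      by (simp add: cl_qtype_def span_zero)
  next
    case False
    then have "blade A \<in> cl_rank p q (card A)" "card A mod 4 = k mod 4"
      using R that by (auto simp: cl_rank_def intro!: span_base)
    then have "blade A \<in> cl_qtype p q k"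
      unfolding cl_qtype_def by (intro span_base) auto
    moreover have "coeff u A *\<^sub>C blade A = Re (coeff u A) *\<^sub>R blade A"
      using R by (intro multivector_eqI) (auto simp: scaleR_conv_of_real)
    ultimately show ?thesis
      by (simp add: cl_qtype_def span_scale)
  qed
  then have "(\<Sum>A\<in>Pow {1..p + q}. coeff u A *\<^sub>C blade A) \<in> cl_qtype p q k"
    unfolding cl_qtype_def by (intro span_sum) auto
  then show "u \<in> cl_qtype p q k"
    using Cl_expand [OF \<open>u \<in> Cl p q\<close>] by simp
qed

lemma cl_qtype_Int:
  assumes "k mod 4 \<noteq> l mod 4"
  shows "cl_qtype p q k \<inter> cl_qtype p q l = {0}"
proof -
  have "u = 0" if "u \<in> cl_qtype p q k" "u \<in> cl_qtype p q l" for u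
    using that assms by (intro multivector_eqI) (force simp: cl_qtype_iff)
  then show ?thesis
    by (auto simp: cl_qtype_def span_zero)
qed

lemma cl_qtype_Int_times_i: "cl_qtype p q k \<inter> times_i (cl_qtype p q l) = {0}"
proof -
  have "v = 0" if "\<i> *\<^sub>C v \<in> cl_qtype p q k" "v \<in> cl_qtype p q l" for v
  proof (rule multivector_eqI)
    fix A
    have "\<i> * coeff v A \<in> \<real>" "coeff v A \<in> \<real>"
      using that by (auto simp: cl_qtype_iff)
    then show "coeff v A = coeff 0 A"
      by (auto simp: complex_is_Real_iff complex_eq_iff)
  qed
  moreover have "0 \<in> times_i (cl_qtype p q l)"
    unfolding times_i_def by (rule image_eqI [of _ _ 0]) (simp_all add: cl_qtype_def span_zero)
  moreover have "0 \<in> cl_qtype p q k"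
    by (simp add: cl_qtype_def span_zero)
  ultimately show ?thesis
    by (fastforce simp: times_i_def)
qed

end

theory Submission
  imports Defs
begin

text \<open>
  Conjugation is an antilinear anti-automorphism that multiplies the basis elements of rank \<open>k\<close> by
  \<open>(-1)\<^bsup>k choose 2\<^esup>\<close>.  Hence \<open>w = 2 \<oplus> 3 \<oplus> i0 \<oplus> i1\<close> is closed under commutators, and each of
  the four subspaces is the intersection of \<open>w\<close> with a real associative subalgebra: the even real
  elements, the even elements, the elements that are real in even and imaginary in odd rank, and the
  real elements.

  The Lie algebra of the group is computed from the Cauchy product of \<open>exp (t u\<^sup>*)\<close> and \<open>exp (t u)\<close>,
  whose linear coefficient is \<open>u\<^sup>* + u\<close>.
\<close>

section \<open>Conjugation\<close>

text \<open>The signature-free factor of \<open>cl_sign\<close>, split off because the other factor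
  is symmetric in \<open>A\<close> and \<open>B\<close> and cancels when the order of a product is
  reversed.\<close>

definition inversion_sign :: "nat set \<Rightarrow> nat set \<Rightarrow> complex" where
  "inversion_sign A B = (- 1) ^ card {(a, b). a \<in> A \<and> b \<in> B \<and> b < a}"

text \<open>Reversing a product of \<open>k\<close> distinct generators exchanges each of the
  \<open>k choose 2\<close> pairs once, and each exchange changes the sign.\<close>

definition reversal_sign :: "nat \<Rightarrow> complex" where
  "reversal_sign k = (- 1) ^ (k choose 2)"

lemma reversal_sign_Suc: "reversal_sign (Suc k) = (- 1) ^ k * reversal_sign k"
  by (simp add: reversal_sign_def numeral_2_eq_2 power_add)

lemma reversal_sign_0 [simp]: "reversal_sign 0 = 1"
  by (simp add: reversal_sign_def numeral_2_eq_2)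

text \<open>The parity of \<open>k choose 2\<close> changes from \<open>k\<close> to
  \<open>Suc k\<close> exactly if \<open>k\<close> is odd. The resulting period 4 links conjugation
  to ranks modulo 4.\<close>

lemma even_choose_two: "even (k choose 2) \<longleftrightarrow> k mod 4 < 2"
proof (induction k)
  case (Suc k)
  have "Suc k choose 2 = k + (k choose 2)"
    by (simp add: numeral_2_eq_2)
  then have "even (Suc k choose 2) \<longleftrightarrow> (even k \<longleftrightarrow> k mod 4 < 2)"
    using Suc by simp
  then show ?case by presburger
qed (simp add: numeral_2_eq_2)

lemma reversal_sign_eq: "reversal_sign k = (if k mod 4 < 2 then 1 else - 1)"
  by (simp add: reversal_sign_def even_choose_two minus_one_power_iff)

lemma inversion_sign_singleton:
  assumes "\<And>b. b \<in> B \<Longrightarrow> b < a"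
  shows "inversion_sign {a} B = (- 1) ^ card B"
proof -
  have "{(x, b). x \<in> {a} \<and> b \<in> B \<and> b < x} = {a} \<times> B"
    using assms by auto
  then show ?thesis
    by (simp only: inversion_sign_def card_cartesian_product_singleton)
qed

text \<open>Every unordered pair of distinct elements gives exactly one inversion. This brings the
  sign of reversal into a form to which \<open>inversion_sign_prod\<close> applies.\<close>

lemma inversion_sign_self:
  assumes "finite A"
  shows "inversion_sign A A = reversal_sign (card A)"
  using assms
proof (induction A rule: finite_linorder_max_induct)
  case empty
  then show ?case by (simp add: inversion_sign_def)
next
  case (insert b A)
  let ?I = "\<lambda>A :: nat set. {(x, y). x \<in> A \<and> y \<in> A \<and> y < x}"
  have eq: "?I (insert b A) = ?I A \<union> {b} \<times> A"
    using insert by auto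
  have "finite (?I A)"
    by (rule finite_subset [of _ "A \<times> A"]) (use insert in auto)
  moreover have "?I A \<inter> {b} \<times> A = {}" "b \<notin> A"
    using insert by auto
  ultimately show ?case
    using insert unfolding inversion_sign_def eq
    by (simp add: card_Un_disjoint power_add reversal_sign_Suc)
qed

text \<open>Written over pairs of indices, signs can be compared factor by factor, where only
  finitely many cases of set membership remain.\<close>

lemma inversion_sign_prod:
  assumes "A \<subseteq> {1..n}" "B \<subseteq> {1..n}"
  shows "inversion_sign A B =
    (\<Prod>i\<in>{1..n}. \<Prod>j\<in>{1..n}. if i \<in> A \<and> j \<in> B \<and> j < i then - 1 else 1)"
proof -
  \<comment> \<open>With \<open>n\<close> in place of \<open>p\<close>, every generator that occurs
    squares to \<open>+1\<close>, so \<open>cl_sign n A B\<close> reduces to the inversion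
    sign.\<close>
  have "(\<Prod>i\<in>{1..n}. if i \<in> A \<and> i \<in> B then cl_eta n i else 1) = 1"
       "(\<Prod>a\<in>A \<inter> B. cl_eta n a) = 1"
    using assms by (auto intro!: prod.neutral simp: cl_eta_def)
  then show ?thesis
    using cl_sign_prod [OF assms, of n] by (simp add: cl_sign_def inversion_sign_def)
qed

lemma cl_sign_eq: "cl_sign p A B = inversion_sign A B * (\<Prod>a\<in>A \<inter> B. cl_eta p a)"
  by (simp only: cl_sign_def inversion_sign_def)

text \<open>For indices \<open>j < i\<close> and 0-1 indicators \<open>a\<close>, \<open>b\<close>
  of the two sets, the exponents \<open>a_i b_j + (a_i + b_i) (a_j + b_j)\<close> and
  \<open>b_i a_j + a_i a_j + b_i b_j\<close> agree modulo 2; the metric factors of both sides are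
  equal.\<close>

lemma cl_sign_reversal:
  assumes "A \<subseteq> {1..n}" "B \<subseteq> {1..n}"
  shows "cl_sign p A B * reversal_sign (card (sym_diff A B)) =
    cl_sign p B A * (reversal_sign (card A) * reversal_sign (card B))"
proof -
  have C: "sym_diff A B \<subseteq> {1..n}"
    using assms by auto
  have fin: "finite A" "finite B" "finite (sym_diff A B)"
    using assms C by (auto intro: finite_subset)
  have "inversion_sign A B * inversion_sign (sym_diff A B) (sym_diff A B) =
      inversion_sign B A * (inversion_sign A A * inversion_sign B B)"
    unfolding inversion_sign_prod [OF assms] inversion_sign_prod [OF assms(2,1)]
      inversion_sign_prod [OF C C] inversion_sign_prod [OF assms(1,1)]
      inversion_sign_prod [OF assms(2,2)] prod.distrib [symmetric]
    by (intro prod.cong refl) auto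
  then show ?thesis
    using fin by (simp add: cl_sign_eq inversion_sign_self Int_commute [of B A] ac_simps)
qed

section \<open>Conjugation in the blade basis\<close>

text \<open>The head \<open>a\<close> exceeds all later letters, so sorting it into place passes
  \<open>length as\<close> generators; these exponents add up to the binomial coefficient.\<close>

lemma cl_word_reverse_sorted:
  assumes "sorted_wrt (>) as" "set as \<subseteq> {1..p + q}"
  shows "cl_word p q as = reversal_sign (length as) *\<^sub>C blade (set as)"
  using assms
proof (induction "as")
  case Nil
  then show ?case by (simp add: cl_word_def cl_one_def)
next
  case (Cons a "as")
  have "distinct as"
    using Cons.prems strict_sorted_iff [of "rev as"] by (simp add: sorted_wrt_rev)
  then have card: "card (set as) = length as"
    by (rule distinct_card)
  have disj: "{a} \<inter> set as = {}"
    using Cons.prems by auto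
  have "cl_sign p {a} (set as) = inversion_sign {a} (set as)"
    unfolding cl_sign_def inversion_sign_def disj by simp
  also have "\<dots> = (- 1) ^ length as"
    using Cons.prems by (subst inversion_sign_singleton) (auto simp: card)
  finally have sign: "cl_sign p {a} (set as) = (- 1) ^ length as" .
  have "cl_word p q (a # as) = reversal_sign (length as) *\<^sub>C cl_mult p q (blade {a}) (blade (set as))"
    using Cons by (simp add: cl_word_def cl_gen_def cl_mult_scale_right)
  also have "\<dots> = reversal_sign (length (a # as)) *\<^sub>C blade (sym_diff {a} (set as))"
    using Cons.prems by (subst cl_mult_blade) (auto simp: sign reversal_sign_Suc mult.commute)
  also have "sym_diff {a} (set as) = set (a # as)"
    using Cons.prems by auto
  finally show ?case .
qed

lemma cl_star_eq:
  "cl_star p q u =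
    (\<Sum>A\<in>Pow {1..p + q}. (cnj (coeff u A) * reversal_sign (card A)) *\<^sub>C blade A)"
  unfolding cl_star_def
proof (intro sum.cong refl)
  fix A assume "A \<in> Pow {1..p + q}"
  then have A: "A \<subseteq> {1..p + q}" and "finite A"
    by (auto intro: finite_subset)
  then have "cl_word p q (rev (sorted_list_of_set A)) = reversal_sign (card A) *\<^sub>C blade A"
    by (subst cl_word_reverse_sorted) (auto simp: sorted_wrt_rev)
  then show "cnj (coeff u A) *\<^sub>C cl_word p q (rev (sorted_list_of_set A)) =
      (cnj (coeff u A) * reversal_sign (card A)) *\<^sub>C blade A"
    by simp
qed

text \<open>Replaces the definition by reversed words: the further properties of conjugation rest on
  this diagonal form.\<close>

lemma coeff_cl_star:
  "coeff (cl_star p q u) A =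
    (if A \<subseteq> {1..p + q} then cnj (coeff u A) * reversal_sign (card A) else 0)"
  by (simp add: cl_star_eq if_distrib cong: if_cong)

lemma cl_star_Cl: "cl_star p q u \<in> Cl p q"
  by (auto simp: Cl_def coeff_cl_star split: if_splits)

lemma cl_star_add: "cl_star p q (u + v) = cl_star p q u + cl_star p q v"
  by (rule multivector_eqI) (simp add: coeff_cl_star algebra_simps)

lemma cl_star_diff: "cl_star p q (u - v) = cl_star p q u - cl_star p q v"
  by (rule multivector_eqI) (simp add: coeff_cl_star algebra_simps)

lemma cl_star_zero [simp]: "cl_star p q 0 = 0"
  by (rule multivector_eqI) (simp add: coeff_cl_star)

lemma cl_star_sum: "cl_star p q (sum f S) = (\<Sum>x\<in>S. cl_star p q (f x))"
  by (induction S rule: infinite_finite_induct) (auto simp: cl_star_add)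

lemma cl_star_scaleC: "cl_star p q (c *\<^sub>C u) = cnj c *\<^sub>C cl_star p q u"
  by (rule multivector_eqI) (simp add: coeff_cl_star)

lemma cl_star_scaleR: "cl_star p q (r *\<^sub>R u) = r *\<^sub>R cl_star p q u"
  by (rule multivector_eqI) (simp add: coeff_cl_star scaleR_conv_of_real)

lemma cl_star_blade:
  "A \<subseteq> {1..p + q} \<Longrightarrow> cl_star p q (blade A) = reversal_sign (card A) *\<^sub>C blade A"
  by (rule multivector_eqI) (auto simp: coeff_cl_star)

lemma cl_star_one: "cl_star p q cl_one = cl_one"
  by (simp add: cl_one_def cl_star_blade)

lemma cl_star_star:
  assumes "u \<in> Cl p q"
  shows "cl_star p q (cl_star p q u) = u"
  using assms by (intro multivector_eqI) (auto simp: coeff_cl_star reversal_sign_eq Cl_def)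

text \<open>Both sides are double sums over blades, so the identity reduces to
  \<open>cl_sign_reversal\<close> for each pair.\<close>

lemma cl_star_mult: "cl_star p q (cl_mult p q u v) = cl_mult p q (cl_star p q v) (cl_star p q u)"
proof -
  let ?P = "Pow {1..p + q}"
  have "cl_star p q (cl_mult p q u v) =
    (\<Sum>A\<in>?P. \<Sum>B\<in>?P. (cnj (coeff u A * coeff v B) *
      (cl_sign p A B * reversal_sign (card (sym_diff A B)))) *\<^sub>C blade (sym_diff A B))"
    unfolding cl_mult_def cl_star_sum
  proof (intro sum.cong refl)
    fix A B assume AB: "A \<in> ?P" "B \<in> ?P"
    have "cnj (cl_sign p A B) = cl_sign p A B"
      by (auto simp: cl_sign_def cl_eta_def intro!: prod.cong)
    moreover have "sym_diff A B \<subseteq> {1..p + q}"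
      using AB by auto
    ultimately show "cl_star p q ((coeff u A * coeff v B * cl_sign p A B) *\<^sub>C blade (sym_diff A B)) =
      (cnj (coeff u A * coeff v B) *
        (cl_sign p A B * reversal_sign (card (sym_diff A B)))) *\<^sub>C blade (sym_diff A B)"
      by (simp add: cl_star_scaleC cl_star_blade mult.assoc)
  qed
  also have "\<dots> = (\<Sum>A\<in>?P. \<Sum>B\<in>?P. (cnj (coeff u A * coeff v B) *
      (cl_sign p B A * (reversal_sign (card A) * reversal_sign (card B)))) *\<^sub>C
        blade (sym_diff A B))"
    by (intro sum.cong refl) (subst cl_sign_reversal [where n = "p + q"], auto)
  \<comment> \<open>Exchanging the sums makes \<open>B\<close> the left factor, as in the product of
    the conjugates.\<close>
  also have "\<dots> = (\<Sum>B\<in>?P. \<Sum>A\<in>?P. (cnj (coeff u A * coeff v B) *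
      (cl_sign p B A * (reversal_sign (card A) * reversal_sign (card B)))) *\<^sub>C
        blade (sym_diff B A))"
    by (subst sum.swap) (simp only: Un_commute)
  also have "\<dots> = cl_mult p q (cl_star p q v) (cl_star p q u)"
    unfolding cl_mult_def by (intro sum.cong refl) (simp add: coeff_cl_star ac_simps)
  finally show ?thesis .
qed


section \<open>The pseudo-unitary group\<close>

lemma subspace_Cl: "subspace (Cl p q)"
proof (rule subspaceI)
  fix c u assume "u \<in> Cl p q"
  then show "c *\<^sub>R u \<in> Cl p q"
    by (auto simp: Cl_def)
qed (auto simp: Cl_zero Cl_add)

lemma Cl_one: "cl_one \<in> Cl p q"
  by (simp add: cl_one_def Cl_blade)

lemma scaleR_eq_scaleC: "r *\<^sub>R u = complex_of_real r *\<^sub>C u"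
  by (rule multivector_eqI) (simp add: scaleR_conv_of_real)

section \<open>Finite dimension and two-sided inverses\<close>

text \<open>The type itself is infinite-dimensional, so finiteness is expressed by a spanning set.
  Scalars are real, hence both \<open>blade A\<close> and its multiple by \<open>\<i>\<close> are
  listed.\<close>

lemma Cl_finite_span: "\<exists>T. finite T \<and> Cl p q \<subseteq> span T"
proof (intro exI conjI subsetI)
  let ?T = "blade ` Pow {1..p + q} \<union> (\<lambda>A. \<i> *\<^sub>C blade A) ` Pow {1..p + q}"
  show "finite ?T" by simp
  fix u assume u: "u \<in> Cl p q"
  have "coeff u A *\<^sub>C blade A \<in> span ?T" if "A \<in> Pow {1..p + q}" for A
  proof -
    have "coeff u A *\<^sub>C blade A =
        Re (coeff u A) *\<^sub>R blade A + Im (coeff u A) *\<^sub>R (\<i> *\<^sub>C blade A)"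
      by (rule multivector_eqI) (simp add: complex_eq_iff)
    moreover have "blade A \<in> span ?T" "\<i> *\<^sub>C blade A \<in> span ?T"
      using that by (auto intro: span_base)
    ultimately show ?thesis
      by (simp add: span_add span_scale)
  qed
  then have "(\<Sum>A\<in>Pow {1..p + q}. coeff u A *\<^sub>C blade A) \<in> span ?T"
    by (intro span_sum)
  then show "u \<in> span ?T"
    using Cl_expand [OF u] by simp
qed

text \<open>The image of a basis is independent and of the same size; a vector of \<open>S\<close>
  outside its span would yield an independent set larger than a basis.\<close>

lemma inj_linear_image_finite_span:
  fixes f :: "'a::real_vector \<Rightarrow> 'a"
  assumes "linear f" "subspace S" "f ` S \<subseteq> S" "inj_on f S" "finite T" "S \<subseteq> span T"
  shows "f ` S = S"
proof -
  obtain B where B: "B \<subseteq> S" "independent B" "S \<subseteq> span B"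
    using real_vector.maximal_independent_subset by blast
  have span_B: "span B = S"
    using B assms(2) by (simp add: span_minimal subset_antisym)
  have fin: "finite B"
    using real_vector.independent_span_bound [OF assms(5) B(2)] B(1) assms(6) by blast
  have inj: "inj_on f (span B)"
    using assms(4) span_B by simp
  have ind: "independent (f ` B)"
    using real_vector.linear_independent_injective_image [OF assms(1) B(2) inj] .
  have card: "card (f ` B) = card B"
    using inj_on_subset [OF assms(4) B(1)] by (rule card_image)
  have "x \<in> span (f ` B)" if "x \<in> S" for x
  proof (rule ccontr)
    assume x: "x \<notin> span (f ` B)"
    then have "independent (insert x (f ` B))"
      using ind by (simp add: real_vector.independent_insert)
    moreover have "insert x (f ` B) \<subseteq> span B"
      using that B(1) assms(3) span_B by blast
    ultimately have "card (insert x (f ` B)) \<le> card B"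
      using real_vector.independent_span_bound [OF fin] by blast
    moreover have "x \<notin> f ` B"
      using x span_base by blast
    ultimately show False
      using card fin by simp
  qed
  moreover have "span (f ` B) = f ` S"
    using linear_span_image [OF assms(1)] span_B by simp
  ultimately show ?thesis
    using assms(3) by blast
qed

text \<open>Left multiplication by \<open>u\<close> is injective because \<open>v\<close> undoes it,
  hence surjective by finite dimension. A solution \<open>w\<close> of \<open>u w = e\<close> then
  equals \<open>v u w = v\<close>.\<close>

lemma cl_left_inverse_imp_right_inverse:
  assumes "u \<in> Cl p q" "v \<in> Cl p q" "cl_mult p q v u = cl_one"
  shows "cl_mult p q u v = cl_one"
proof -
  let ?f = "cl_mult p q u"
  have "linear ?f"
    by (rule linearI) (simp_all add: cl_mult_add_right scaleR_eq_scaleC cl_mult_scale_right)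
  moreover have left: "cl_mult p q v (?f x) = x" if "x \<in> Cl p q" for x
    using assms that by (simp add: cl_mult_assoc [symmetric] cl_mult_one)
  then have "inj_on ?f (Cl p q)"
    by (rule inj_on_inverseI)
  ultimately have "?f ` Cl p q = Cl p q"
    using inj_linear_image_finite_span [of ?f "Cl p q"] Cl_finite_span [of p q] subspace_Cl Cl_mult
    by blast
  then obtain w where w: "w \<in> Cl p q" "?f w = cl_one"
    using Cl_one by (metis imageE)
  then have "w = v"
    using left [OF w(1)] assms by (simp add: cl_mult_one)
  with w show ?thesis by simp
qed

lemma group_WCl: "group (WCl p q)"
proof (rule groupI)
  fix u v assume "u \<in> carrier (WCl p q)" "v \<in> carrier (WCl p q)"
  then have u: "u \<in> Cl p q" "cl_mult p q (cl_star p q u) u = cl_one"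
    and v: "v \<in> Cl p q" "cl_mult p q (cl_star p q v) v = cl_one"
    by (auto simp: WCl_def)
  have "cl_mult p q (cl_star p q u) (cl_mult p q u v) = v"
    using u v by (simp add: cl_mult_assoc [symmetric] cl_star_Cl cl_mult_one)
  then have "cl_mult p q (cl_star p q (cl_mult p q u v)) (cl_mult p q u v) = cl_one"
    using v by (simp add: cl_star_mult cl_mult_assoc Cl_mult cl_star_Cl)
  then show "u \<otimes>\<^bsub>WCl p q\<^esub> v \<in> carrier (WCl p q)"
    by (simp add: WCl_def Cl_mult)
next
  show "\<one>\<^bsub>WCl p q\<^esub> \<in> carrier (WCl p q)"
    by (simp add: WCl_def Cl_one cl_star_one cl_mult_one)
next
  fix u assume "u \<in> carrier (WCl p q)"
  then have u: "u \<in> Cl p q" "cl_mult p q (cl_star p q u) u = cl_one"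
    by (auto simp: WCl_def)
  \<comment> \<open>Since conjugation is an involution, the inverse \<open>cl_star p q u\<close>
    lies in the group only if this product in the other order is the identity.\<close>
  then have "cl_mult p q u (cl_star p q u) = cl_one"
    using cl_left_inverse_imp_right_inverse cl_star_Cl by blast
  then show "\<exists>v\<in>carrier (WCl p q). v \<otimes>\<^bsub>WCl p q\<^esub> u = \<one>\<^bsub>WCl p q\<^esub>"
    using u by (intro bexI [of _ "cl_star p q u"]) (auto simp: WCl_def cl_star_Cl cl_star_star)
qed (auto simp: WCl_def cl_mult_assoc cl_mult_one)


section \<open>The exponential series\<close>

text \<open>On \<open>Cl p q\<close> this is the l1 norm of the coordinates; it serves to dominate
  the exponential series in each of them.\<close>

definition cl_norm :: "nat \<Rightarrow> nat \<Rightarrow> multivector \<Rightarrow> real" where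
  "cl_norm p q u = (\<Sum>A\<in>Pow {1..p + q}. norm (coeff u A))"

lemma cl_norm_nonneg: "0 \<le> cl_norm p q u"
  by (simp add: cl_norm_def sum_nonneg)

lemma norm_coeff_le:
  assumes "u \<in> Cl p q"
  shows "norm (coeff u A) \<le> cl_norm p q u"
proof (cases "A \<in> Pow {1..p + q}")
  case True
  then show ?thesis
    unfolding cl_norm_def
    by (intro member_le_sum [of A _ "\<lambda>A. norm (coeff u A)"]) auto
next
  case False
  then have "coeff u A = 0"
    using assms unfolding Cl_def by blast
  then show ?thesis
    by (simp add: cl_norm_nonneg)
qed

lemma cl_norm_add: "cl_norm p q (u + v) \<le> cl_norm p q u + cl_norm p q v"
  unfolding cl_norm_def sum.distrib [symmetric] by (intro sum_mono) (simp add: norm_triangle_ineq)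

lemma cl_norm_sum: "cl_norm p q (sum f S) \<le> (\<Sum>x\<in>S. cl_norm p q (f x))"
proof (induction S rule: infinite_finite_induct)
  case (insert x S)
  then show ?case
    using cl_norm_add [of p q "f x" "sum f S"] by simp
qed (simp_all add: cl_norm_def)

lemma cl_norm_scale_blade: "cl_norm p q (c *\<^sub>C blade A) \<le> norm c"
  by (simp add: cl_norm_def if_distrib cong: if_cong)

lemma norm_cl_sign [simp]: "norm (cl_sign p A B) = 1"
proof -
  have "(\<Prod>a\<in>A \<inter> B. norm (cl_eta p a)) = 1"
    by (intro prod.neutral) (auto simp: cl_eta_def)
  then show ?thesis
    by (simp add: cl_sign_def norm_mult norm_power prod_norm)
qed

text \<open>Blades multiply to blades up to a sign, so each pair of terms contributes at most the
  product of its norms.\<close>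

lemma cl_norm_mult: "cl_norm p q (cl_mult p q u v) \<le> cl_norm p q u * cl_norm p q v"
proof -
  let ?P = "Pow {1..p + q}"
  have "cl_norm p q (cl_mult p q u v) \<le> (\<Sum>A\<in>?P. \<Sum>B\<in>?P.
      cl_norm p q ((coeff u A * coeff v B * cl_sign p A B) *\<^sub>C blade (sym_diff A B)))"
    unfolding cl_mult_def by (intro order_trans [OF cl_norm_sum] sum_mono order_refl)
  also have "\<dots> \<le> (\<Sum>A\<in>?P. \<Sum>B\<in>?P. norm (coeff u A) * norm (coeff v B))"
    by (intro sum_mono order_trans [OF cl_norm_scale_blade]) (simp add: norm_mult)
  also have "\<dots> = cl_norm p q u * cl_norm p q v"
    by (simp add: cl_norm_def sum_product)
  finally show ?thesis .
qed

lemma cl_power_Cl: "cl_power p q u k \<in> Cl p q"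
  by (cases k) (simp_all add: Cl_one Cl_mult)

lemma cl_norm_power: "cl_norm p q (cl_power p q u k) \<le> cl_norm p q u ^ k"
proof (induction k)
  case 0
  then show ?case
    using cl_norm_scale_blade [of p q 1 "{}"] by (simp add: cl_one_def)
next
  case (Suc k)
  then show ?case
    using cl_norm_mult [of p q u "cl_power p q u k"] cl_norm_nonneg [of p q u]
    by (simp add: mult_left_mono order_trans)
qed

lemma cl_power_scaleC: "cl_power p q (c *\<^sub>C u) k = c ^ k *\<^sub>C cl_power p q u k"
  by (induction k) (simp_all add: cl_mult_scale_left cl_mult_scale_right ac_simps)

lemma cl_power_add:
  assumes "u \<in> Cl p q"
  shows "cl_mult p q (cl_power p q u i) (cl_power p q u j) = cl_power p q u (i + j)"
  by (induction i) (simp_all add: assms cl_mult_one cl_power_Cl cl_mult_assoc)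

lemma cl_power_Suc_right:
  assumes "u \<in> Cl p q"
  shows "cl_mult p q (cl_power p q u k) u = cl_power p q u (Suc k)"
  using cl_power_add [OF assms, of k 1] assms by (simp add: cl_mult_one)

lemma cl_star_power:
  assumes "u \<in> Cl p q"
  shows "cl_star p q (cl_power p q u k) = cl_power p q (cl_star p q u) k"
proof (induction k)
  case (Suc k)
  then show ?case
    using cl_power_Suc_right [OF cl_star_Cl, of p q u k] by (simp add: cl_star_mult)
qed (simp add: cl_star_one)

section \<open>Coordinatewise convergence of the exponential series\<close>

definition exp_term :: "nat \<Rightarrow> nat \<Rightarrow> multivector \<Rightarrow> nat \<Rightarrow> multivector" where
  "exp_term p q u k = (1 / fact k) *\<^sub>C cl_power p q u k"

text \<open>Each coordinate is dominated by the norm, and submultiplicativity bounds the terms by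
  those of the real exponential series at \<open>cl_norm p q u\<close>.\<close>

lemma summable_norm_exp_term: "summable (\<lambda>k. norm (coeff (exp_term p q u k) A))"
proof (rule summable_comparison_test')
  show "summable (\<lambda>k. inverse (fact k) * cl_norm p q u ^ k)"
    by (rule summable_exp)
  fix k :: nat
  have "norm (coeff (cl_power p q u k) A) \<le> cl_norm p q u ^ k"
    using norm_coeff_le [OF cl_power_Cl] cl_norm_power order_trans by blast
  then show "norm (norm (coeff (exp_term p q u k) A)) \<le> inverse (fact k) * cl_norm p q u ^ k"
    by (simp add: exp_term_def norm_mult norm_divide divide_simps)
qed

lemma coeff_cl_exp: "coeff (cl_exp p q u) A = (\<Sum>k. coeff (exp_term p q u k) A)"
  by (simp add: cl_exp_def exp_term_def multivector_of_inverse)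

lemma coeff_cl_exp_sums: "(\<lambda>k. coeff (exp_term p q u k) A) sums coeff (cl_exp p q u) A"
  unfolding coeff_cl_exp by (rule summable_sums [OF summable_norm_cancel [OF summable_norm_exp_term]])

lemma cl_exp_Cl: "cl_exp p q u \<in> Cl p q"
proof -
  have "coeff (cl_exp p q u) A = 0" if "\<not> A \<subseteq> {1..p + q}" for A
  proof -
    have "coeff (exp_term p q u k) A = 0" for k
      using that cl_power_Cl [of p q u k] by (auto simp: Cl_def exp_term_def)
    then show ?thesis
      by (simp add: coeff_cl_exp)
  qed
  then show ?thesis
    by (auto simp: Cl_def)
qed

text \<open>On each coordinate conjugation is complex conjugation times a fixed sign, so it passes
  through the convergent series term by term.\<close>

lemma cl_star_exp:
  assumes "u \<in> Cl p q"
  shows "cl_star p q (cl_exp p q u) = cl_exp p q (cl_star p q u)"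
proof (rule multivector_eqI)
  fix A
  show "coeff (cl_star p q (cl_exp p q u)) A = coeff (cl_exp p q (cl_star p q u)) A"
  proof (cases "A \<subseteq> {1..p + q}")
    case True
    have "(\<lambda>k. cnj (coeff (exp_term p q u k) A) * reversal_sign (card A)) sums
        (cnj (coeff (cl_exp p q u) A) * reversal_sign (card A))"
      by (intro sums_mult2) (simp add: sums_cnj coeff_cl_exp_sums)
    moreover have "cnj (coeff (exp_term p q u k) A) * reversal_sign (card A) =
        coeff (exp_term p q (cl_star p q u) k) A" for k
      using True by (simp add: exp_term_def coeff_cl_star cl_star_power [OF assms, symmetric])
    ultimately show ?thesis
      using True coeff_cl_exp_sums [of p q "cl_star p q u" A] by (simp add: coeff_cl_star sums_unique2)
  next
    case False
    then show ?thesis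
      using cl_exp_Cl [of p q "cl_star p q u"] by (auto simp: coeff_cl_star Cl_def)
  qed
qed

section \<open>Cauchy products of exponential series\<close>

lemma coeff_cl_mult:
  "coeff (cl_mult p q u v) C = (\<Sum>A\<in>Pow {1..p + q}. \<Sum>B\<in>Pow {1..p + q}.
     coeff u A * coeff v B * (cl_sign p A B * coeff (blade (sym_diff A B)) C))"
  by (simp add: cl_mult_def mult.assoc)

text \<open>The degree \<open>k\<close> part of the product of two exponential series, with the
  factors kept in order because \<open>u\<close> and \<open>v\<close> may fail to commute.\<close>

definition exp_product_term :: "nat \<Rightarrow> nat \<Rightarrow> multivector \<Rightarrow> multivector \<Rightarrow> nat \<Rightarrow> multivector" where
  "exp_product_term p q u v k = (\<Sum>i\<le>k. cl_mult p q (exp_term p q u i) (exp_term p q v (k - i)))"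

text \<open>Absolute convergence gives the scalar Cauchy product for each pair of coordinates; a
  finite combination with the structure constants yields the coordinate of the product.\<close>

lemma cl_exp_product_sums:
  "(\<lambda>k. coeff (exp_product_term p q u v k) C) sums
     coeff (cl_mult p q (cl_exp p q u) (cl_exp p q v)) C"
proof -
  let ?P = "Pow {1..p + q}"
  let ?d = "\<lambda>A B. cl_sign p A B * coeff (blade (sym_diff A B)) C"
  have "(\<lambda>k. \<Sum>A\<in>?P. \<Sum>B\<in>?P.
      (\<Sum>i\<le>k. coeff (exp_term p q u i) A * coeff (exp_term p q v (k - i)) B) * ?d A B) sums
     coeff (cl_mult p q (cl_exp p q u) (cl_exp p q v)) C"
    unfolding coeff_cl_mult coeff_cl_exp
    by (intro sums_sum sums_mult2 Cauchy_product_sums summable_norm_exp_term)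
  moreover have "(\<Sum>A\<in>?P. \<Sum>B\<in>?P.
      (\<Sum>i\<le>k. coeff (exp_term p q u i) A * coeff (exp_term p q v (k - i)) B) * ?d A B) =
      coeff (exp_product_term p q u v k) C" for k
  proof -
    have "coeff (exp_product_term p q u v k) C = (\<Sum>i\<le>k. \<Sum>A\<in>?P. \<Sum>B\<in>?P.
        coeff (exp_term p q u i) A * coeff (exp_term p q v (k - i)) B * ?d A B)"
      by (simp only: exp_product_term_def coeff_sum coeff_cl_mult)
    also have "\<dots> = (\<Sum>A\<in>?P. \<Sum>i\<le>k. \<Sum>B\<in>?P.
        coeff (exp_term p q u i) A * coeff (exp_term p q v (k - i)) B * ?d A B)"
      by (rule sum.swap)
    also have "\<dots> = (\<Sum>A\<in>?P. \<Sum>B\<in>?P. \<Sum>i\<le>k.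
        coeff (exp_term p q u i) A * coeff (exp_term p q v (k - i)) B * ?d A B)"
      by (intro sum.cong refl sum.swap)
    finally show ?thesis
      by (simp only: sum_distrib_right)
  qed
  ultimately show ?thesis
    by (simp only:)
qed

lemma exp_term_scaleC: "exp_term p q (c *\<^sub>C u) k = c ^ k *\<^sub>C exp_term p q u k"
  by (simp add: exp_term_def cl_power_scaleC)

text \<open>This homogeneity turns the product of the exponentials of \<open>t u\<close> and
  \<open>t v\<close> into a power series in \<open>t\<close>.\<close>

lemma exp_product_term_scaleC:
  "exp_product_term p q (c *\<^sub>C u) (c *\<^sub>C v) k = c ^ k *\<^sub>C exp_product_term p q u v k"
  unfolding exp_product_term_def scaleC_sum
  by (intro sum.cong refl)
     (simp add: exp_term_scaleC cl_mult_scale_left cl_mult_scale_right flip: power_add)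

text \<open>Powers of \<open>u\<close> combine, and the coefficient left over is an alternating sum
  of binomial coefficients, which vanishes for positive \<open>k\<close>.\<close>

lemma exp_product_term_minus:
  assumes "u \<in> Cl p q"
  shows "exp_product_term p q (- u) u k = (if k = 0 then cl_one else 0)"
proof -
  have minus: "- u = (- 1) *\<^sub>C u"
    by (rule multivector_eqI) simp
  have "cl_mult p q (exp_term p q (- u) i) (exp_term p q u (k - i)) =
      ((- 1) ^ i * of_nat (k choose i) / fact k) *\<^sub>C cl_power p q u k" if "i \<le> k" for i
    using that cl_power_add [OF assms, of i "k - i"]
    unfolding minus exp_term_scaleC
    by (simp add: exp_term_def cl_mult_scale_left cl_mult_scale_right binomial_fact field_simps)
  then have "exp_product_term p q (- u) u k =
      (\<Sum>i\<le>k. ((- 1) ^ i * of_nat (k choose i) / fact k) *\<^sub>C cl_power p q u k)"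
    unfolding exp_product_term_def by (intro sum.cong) auto
  also have "\<dots> = ((\<Sum>i\<le>k. (- 1) ^ i * of_nat (k choose i)) / fact k) *\<^sub>C cl_power p q u k"
    by (rule multivector_eqI) (simp add: sum_distrib_right sum_divide_distrib)
  also have "\<dots> = (if k = 0 then cl_one else 0)"
    using choose_alternating_sum [of k, where ?'a = complex] by simp
  finally show ?thesis .
qed

lemma cl_exp_minus_mult:
  assumes "u \<in> Cl p q"
  shows "cl_mult p q (cl_exp p q (- u)) (cl_exp p q u) = cl_one"
proof (rule multivector_eqI)
  fix C
  have "(\<lambda>k. if k = 0 then coeff cl_one C else 0) sums coeff cl_one C"
    using sums_single [of 0 "\<lambda>_. coeff cl_one C"] by simp
  moreover have "(\<lambda>k. if k = 0 then coeff cl_one C else 0) sums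
      coeff (cl_mult p q (cl_exp p q (- u)) (cl_exp p q u)) C"
    using cl_exp_product_sums [of p q "- u" u C]
    by (simp add: exp_product_term_minus [OF assms] if_distrib if_distribR cong: if_cong)
  ultimately show "coeff (cl_mult p q (cl_exp p q (- u)) (cl_exp p q u)) C = coeff cl_one C"
    using sums_unique2 by blast
qed

section \<open>Power series that are constant in a real variable\<close>

text \<open>The derivative at 0 is computed twice: term by term, and as that of a constant.\<close>

lemma real_powser_const_imp_linear_coeff_zero:
  fixes d :: "nat \<Rightarrow> real"
  assumes "\<And>t. (\<lambda>k. d k * t ^ k) sums c"
  shows "d 1 = 0"
proof -
  have "((\<lambda>t. \<Sum>k. d k * t ^ k) has_field_derivative (\<Sum>k. diffs d k * 0 ^ k)) (at 0)"
    by (rule termdiffs_strong_converges_everywhere) (use assms in \<open>auto simp: sums_iff\<close>)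
  moreover have "(\<Sum>k. d k * t ^ k) = c" for t
    using assms sums_unique by metis
  \<comment> \<open>At 0 only the term \<open>k = 0\<close> of the derived series survives, and
    \<open>diffs d 0\<close> is \<open>d 1\<close>.\<close>
  ultimately have "((\<lambda>_. c) has_field_derivative d 1) (at 0)"
    by (simp add: powser_zero diffs_def)
  then show ?thesis
    using DERIV_const DERIV_unique by blast
qed

text \<open>The parameter runs over the reals only, so real and imaginary parts are treated as two
  real power series.\<close>

lemma complex_powser_const_imp_linear_coeff_zero:
  fixes d :: "nat \<Rightarrow> complex"
  assumes "\<And>t :: real. (\<lambda>k. of_real t ^ k * d k) sums c"
  shows "d 1 = 0"
proof (rule complex_eqI)
  have re_im: "(\<lambda>k. Re (d k) * t ^ k) sums Re c" "(\<lambda>k. Im (d k) * t ^ k) sums Im c" for t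
    using sums_Re [OF assms, of t] sums_Im [OF assms, of t]
    by (simp_all add: mult.commute flip: of_real_power)
  show "Re (d 1) = Re 0" "Im (d 1) = Im 0"
    using real_powser_const_imp_linear_coeff_zero [OF re_im(1)]
      real_powser_const_imp_linear_coeff_zero [OF re_im(2)] by simp_all
qed

lemma lie_algebra_of_WCl: "lie_algebra_of p q (WCl p q) = wCl p q"
proof (intro equalityI subsetI)
  fix u assume "u \<in> wCl p q"
  then have u: "u \<in> Cl p q" "cl_star p q u = - u"
    by (auto simp: wCl_def)
  have "cl_exp p q (t *\<^sub>R u) \<in> carrier (WCl p q)" for t
  proof -
    have tu: "t *\<^sub>R u \<in> Cl p q"
      using u(1) subspace_Cl subspace_scale by blast
    \<comment> \<open>For \<open>u\<close> in \<open>wCl p q\<close> conjugation turns the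
      exponential into its inverse, which is the unitarity condition.\<close>
    have "cl_star p q (cl_exp p q (t *\<^sub>R u)) = cl_exp p q (- (t *\<^sub>R u))"
      using u tu by (simp add: cl_star_exp cl_star_scaleR)
    then show ?thesis
      using cl_exp_minus_mult [OF tu] by (simp add: WCl_def cl_exp_Cl)
  qed
  then show "u \<in> lie_algebra_of p q (WCl p q)"
    using u by (simp add: lie_algebra_of_def)
next
  fix u assume "u \<in> lie_algebra_of p q (WCl p q)"
  then have u: "u \<in> Cl p q"
    and exp: "\<And>t. cl_mult p q (cl_star p q (cl_exp p q (t *\<^sub>R u))) (cl_exp p q (t *\<^sub>R u)) = cl_one"
    by (auto simp: lie_algebra_of_def WCl_def)
  let ?d = "exp_product_term p q (cl_star p q u) u"
  have "coeff (?d 1) C = 0" for C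
  proof (rule complex_powser_const_imp_linear_coeff_zero)
    fix t :: real
    have "cl_star p q (cl_exp p q (t *\<^sub>R u)) = cl_exp p q (complex_of_real t *\<^sub>C cl_star p q u)"
      using u Cl_scaleC by (simp add: scaleR_eq_scaleC cl_star_exp cl_star_scaleC)
    then have "coeff (cl_mult p q (cl_exp p q (complex_of_real t *\<^sub>C cl_star p q u))
        (cl_exp p q (complex_of_real t *\<^sub>C u))) C = coeff cl_one C"
      using exp [of t] by (simp add: scaleR_eq_scaleC)
    then show "(\<lambda>k. of_real t ^ k * coeff (?d k) C) sums coeff cl_one C"
      using cl_exp_product_sums [of p q "complex_of_real t *\<^sub>C cl_star p q u" "complex_of_real t *\<^sub>C u" C]
      by (simp add: exp_product_term_scaleC)
  qed
  then have "?d 1 = 0"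
    by (intro multivector_eqI) simp
  \<comment> \<open>The summands \<open>i = 0\<close> and \<open>i = 1\<close> contribute
    \<open>u\<close> and its conjugate, each multiplied by the identity.\<close>
  moreover have "?d 1 = u + cl_star p q u"
    using u by (simp add: exp_product_term_def exp_term_def cl_mult_one cl_star_Cl)
  ultimately show "u \<in> wCl p q"
    using u by (simp add: wCl_def eq_neg_iff_add_eq_0 add.commute)
qed


section \<open>Subspaces given by conditions on the coefficients\<close>

text \<open>All spaces of the theorem have this form, so sums, intersections and multiplication by
  \<open>\<i>\<close> become operations on sets of complex numbers, one for each rank modulo
  4.\<close>

definition coeff_space :: "nat \<Rightarrow> nat \<Rightarrow> (nat \<Rightarrow> complex set) \<Rightarrow> multivector set" where
  "coeff_space p q S = {u \<in> Cl p q. \<forall>A. coeff u A \<in> S (card A mod 4)}"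

abbreviation imaginary :: "complex set" where
  "imaginary \<equiv> {z. Re z = 0}"

text \<open>Ranks enter only modulo 4, so comparing two such spaces takes four equations between
  sets of scalars.\<close>

lemma coeff_space_cong:
  assumes "S 0 = T 0" "S 1 = T 1" "S 2 = T 2" "S 3 = T 3"
  shows "coeff_space p q S = coeff_space p q T"
proof -
  have "S (k mod 4) = T (k mod 4)" for k
  proof -
    have "k mod 4 = 0 \<or> k mod 4 = 1 \<or> k mod 4 = 2 \<or> k mod 4 = 3"
      by presburger
    then show ?thesis
      using assms by (elim disjE) simp_all
  qed
  then show ?thesis
    by (simp add: coeff_space_def)
qed

lemma coeff_space_Int: "coeff_space p q S \<inter> coeff_space p q T = coeff_space p q (\<lambda>j. S j \<inter> T j)"
  by (auto simp: coeff_space_def)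

lemma subspace_coeff_space:
  assumes "\<And>j. subspace (S j)"
  shows "subspace (coeff_space p q S)"
proof (rule subspaceI)
  show "0 \<in> coeff_space p q S"
    by (simp add: coeff_space_def Cl_zero subspace_0 [OF assms])
next
  fix u v assume "u \<in> coeff_space p q S" "v \<in> coeff_space p q S"
  then show "u + v \<in> coeff_space p q S"
    by (simp add: coeff_space_def Cl_add subspace_add [OF assms])
next
  fix c u assume "u \<in> coeff_space p q S"
  then show "c *\<^sub>R u \<in> coeff_space p q S"
    using subspace_scale [OF subspace_Cl] subspace_scale [OF assms]
    by (simp add: coeff_space_def)
qed

lemma cl_qtype_eq_coeff_space:
  "cl_qtype p q k = coeff_space p q (\<lambda>j. if j = k mod 4 then \<real> else {0})"
proof (rule Set.set_eqI)
  fix u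
  show "u \<in> cl_qtype p q k \<longleftrightarrow> u \<in> coeff_space p q (\<lambda>j. if j = k mod 4 then \<real> else {0})"
    unfolding cl_qtype_iff coeff_space_def Cl_def by (auto split: if_splits) (metis Reals_0)
qed

lemma times_i_coeff_space:
  "times_i (coeff_space p q S) = coeff_space p q (\<lambda>j. (*) \<i> ` S j)"
proof (intro equalityI subsetI)
  fix u assume u: "u \<in> coeff_space p q (\<lambda>j. (*) \<i> ` S j)"
  have "- \<i> * z \<in> S j" if "z \<in> (*) \<i> ` S j" for z j
    using that by auto
  then have "(- \<i>) *\<^sub>C u \<in> coeff_space p q S"
    using u by (auto simp: coeff_space_def Cl_def)
  moreover have "u = \<i> *\<^sub>C ((- \<i>) *\<^sub>C u)"
    by simp
  ultimately show "u \<in> times_i (coeff_space p q S)"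
    unfolding times_i_def by blast
qed (auto simp: times_i_def coeff_space_def Cl_scaleC)

text \<open>At each residue one of the two sets is \<open>{0}\<close>, so their union coincides with
  their sum.\<close>

lemma subspace_sum_coeff_space:
  assumes "\<And>j. 0 \<in> S j" "\<And>j. 0 \<in> T j" "\<And>j. S j = {0} \<or> T j = {0}"
  shows "coeff_space p q S \<oplus>\<^sub>S coeff_space p q T = coeff_space p q (\<lambda>j. S j \<union> T j)"
proof (intro equalityI subsetI)
  fix u assume "u \<in> coeff_space p q S \<oplus>\<^sub>S coeff_space p q T"
  then obtain v w where vw: "v \<in> coeff_space p q S" "w \<in> coeff_space p q T" "u = v + w"
    by (auto simp: subspace_sum_def)
  have "coeff v A + coeff w A \<in> S (card A mod 4) \<union> T (card A mod 4)" for A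
  proof -
    have "coeff v A \<in> S (card A mod 4)" "coeff w A \<in> T (card A mod 4)"
      using vw by (simp_all add: coeff_space_def)
    then show ?thesis
      using assms(3) [of "card A mod 4"] by (elim disjE) simp_all
  qed
  then show "u \<in> coeff_space p q (\<lambda>j. S j \<union> T j)"
    using vw by (simp add: coeff_space_def Cl_add)
next
  fix u assume u: "u \<in> coeff_space p q (\<lambda>j. S j \<union> T j)"
  \<comment> \<open>Coefficients go to \<open>v\<close> at the residues where \<open>T\<close> is
    trivial and otherwise stay in \<open>u - v\<close>.\<close>
  define v where "v = multivector_of (\<lambda>A. if T (card A mod 4) = {0} then coeff u A else 0)"
  have v: "coeff v A = (if T (card A mod 4) = {0} then coeff u A else 0)" for A
    by (simp add: v_def multivector_of_inverse)
  have in_union: "coeff u A \<in> S (card A mod 4) \<union> T (card A mod 4)" for A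
    using u by (simp add: coeff_space_def)
  have "coeff v A \<in> S (card A mod 4)" "coeff (u - v) A \<in> T (card A mod 4)" for A
  proof -
    have "coeff v A \<in> S (card A mod 4) \<and> coeff (u - v) A \<in> T (card A mod 4)"
    proof (cases "T (card A mod 4) = {0}")
      case True
      then have "coeff u A \<in> S (card A mod 4)"
        using in_union [of A] assms(1) [of "card A mod 4"] by (metis Un_iff singletonD)
      with True show ?thesis
        by (simp add: v)
    next
      case False
      then have "coeff u A \<in> T (card A mod 4)"
        using in_union [of A] assms(2,3) [of "card A mod 4"] by (metis Un_iff singletonD)
      with False assms(1) show ?thesis
        by (simp add: v)
    qed
    then show "coeff v A \<in> S (card A mod 4)" "coeff (u - v) A \<in> T (card A mod 4)"
      by blast+
  qed
  moreover have "v \<in> Cl p q" "u - v \<in> Cl p q"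
    using u by (auto simp: coeff_space_def Cl_def v split: if_splits)
  ultimately have "v \<in> coeff_space p q S" "u - v \<in> coeff_space p q T"
    by (auto simp: coeff_space_def)
  moreover have "u = v + (u - v)"
    by simp
  ultimately show "u \<in> coeff_space p q S \<oplus>\<^sub>S coeff_space p q T"
    unfolding subspace_sum_def by blast
qed

text \<open>On a blade with reversal sign \<open>s\<close> the defining condition reads
  \<open>cnj c * s = - c\<close>: the coefficient \<open>c\<close> is imaginary if
  \<open>s = 1\<close>, that is in ranks 0 and 1 modulo 4, and real if
  \<open>s = - 1\<close>.\<close>

lemma wCl_eq_coeff_space: "wCl p q = coeff_space p q (\<lambda>j. if j < 2 then imaginary else \<real>)"
proof (rule Set.set_eqI)
  fix u
  show "u \<in> wCl p q \<longleftrightarrow> u \<in> coeff_space p q (\<lambda>j. if j < 2 then imaginary else \<real>)"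
  proof (cases "u \<in> Cl p q")
    case True
    have "coeff (cl_star p q u) A = - coeff u A \<longleftrightarrow>
        coeff u A \<in> (if card A mod 4 < 2 then imaginary else \<real>)" for A
    proof (cases "A \<subseteq> {1..p + q}")
      case True
      then show ?thesis
        by (simp add: coeff_cl_star reversal_sign_eq complex_eq_iff complex_is_Real_iff)
    next
      case False
      with \<open>u \<in> Cl p q\<close> have "coeff u A = 0"
        by (auto simp: Cl_def)
      with False show ?thesis
        by (simp add: coeff_cl_star)
    qed
    moreover have "cl_star p q u = - u \<longleftrightarrow> (\<forall>A. coeff (cl_star p q u) A = - coeff u A)"
      by (metis multivector_eqI uminus_multivector.rep_eq)
    ultimately show ?thesis
      using True by (simp add: wCl_def coeff_space_def)
  qed (simp add: wCl_def coeff_space_def)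
qed


section \<open>Closure under commutators\<close>

text \<open>The two minus signs cancel, so the conjugate of \<open>u v\<close> is
  \<open>v u\<close>, and conjugating \<open>u v - v u\<close> exchanges its terms.\<close>

lemma cl_comm_wCl:
  assumes "u \<in> wCl p q" "v \<in> wCl p q"
  shows "cl_comm p q u v \<in> wCl p q"
proof -
  have minus: "- x = (- 1) *\<^sub>C x" for x
    by (rule multivector_eqI) simp
  have "cl_mult p q (- x) (- y) = cl_mult p q x y" for x y
    by (simp add: minus cl_mult_scale_left cl_mult_scale_right)
  moreover have "cl_comm p q u v \<in> Cl p q"
    unfolding cl_comm_def by (intro subspace_diff [OF subspace_Cl] Cl_mult)
  ultimately show ?thesis
    using assms by (simp add: wCl_def cl_comm_def cl_star_diff cl_star_mult)
qed

section \<open>The grading by parity of the rank\<close>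

text \<open>The two cardinalities add up to that of the symmetric difference plus twice that of the
  intersection. Hence parities of ranks add when blades are multiplied.\<close>

lemma even_card_sym_diff:
  assumes "finite A" "finite B"
  shows "even (card (sym_diff A B)) \<longleftrightarrow> (even (card A) \<longleftrightarrow> even (card B))"
proof -
  have "card (sym_diff A B) = card (A - B) + card (B - A)"
    using assms by (intro card_Un_disjoint) auto
  moreover have "card A = card (A - B) + card (A \<inter> B)" "card B = card (B - A) + card (A \<inter> B)"
    using card_Int_Diff [OF assms(1), of B] card_Int_Diff [OF assms(2), of A]
    by (simp_all add: Int_commute)
  ultimately show ?thesis
    by (cases "even (card (A \<inter> B))") simp_all
qed

lemma cl_sign_cases: "cl_sign p A B = 1 \<or> cl_sign p A B = - 1"
proof -
  have "(\<Prod>a\<in>X. cl_eta p a) \<in> {1, - 1}" for X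
    by (induction X rule: infinite_finite_induct) (auto simp: cl_eta_def)
  from this [of "A \<inter> B"] show ?thesis
    by (auto simp: cl_sign_def minus_one_power_iff)
qed

text \<open>The hypotheses send a product of scalars from \<open>E\<close> and \<open>D\<close> into
  the set belonging to the sum of their parities; blades follow the same rule up to sign.\<close>

lemma cl_mult_parity_space:
  fixes E D :: "complex set"
  assumes sub: "subspace E" "subspace D"
    and mult: "\<And>x y. x \<in> E \<Longrightarrow> y \<in> E \<Longrightarrow> x * y \<in> E"
      "\<And>x y. x \<in> E \<Longrightarrow> y \<in> D \<Longrightarrow> x * y \<in> D"
      "\<And>x y. x \<in> D \<Longrightarrow> y \<in> D \<Longrightarrow> x * y \<in> E"
    and uv: "u \<in> coeff_space p q (\<lambda>j. if even j then E else D)"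
      "v \<in> coeff_space p q (\<lambda>j. if even j then E else D)"
  shows "cl_mult p q u v \<in> coeff_space p q (\<lambda>j. if even j then E else D)"
proof -
  let ?S = "\<lambda>A :: nat set. if even (card A) then E else D"
  have even_mod: "even (k mod 4) \<longleftrightarrow> even k" for k :: nat
    by presburger
  have S: "subspace (?S A)" for A
    using sub by simp
  have coeffs: "coeff u A \<in> ?S A" "coeff v A \<in> ?S A" for A
    using uv by (simp_all add: coeff_space_def even_mod)
  have "coeff (cl_mult p q u v) C \<in> ?S C" for C
    unfolding coeff_cl_mult
  proof (intro subspace_sum [OF S])
    fix A B assume "A \<in> Pow {1..p + q}" "B \<in> Pow {1..p + q}"
    then have fin: "finite A" "finite B"
      by (auto intro: finite_subset)
    show "coeff u A * coeff v B * (cl_sign p A B * coeff (blade (sym_diff A B)) C) \<in> ?S C"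
    proof (cases "sym_diff A B = C")
      case True
      \<comment> \<open>For odd \<open>A\<close> and even \<open>B\<close> the mixed hypothesis is
        applied with the scalar factors exchanged.\<close>
      have "coeff u A * coeff v B \<in> ?S C"
        using coeffs(1) [of A] coeffs(2) [of B] mult mult(2) [of "coeff v B" "coeff u A"]
        unfolding True [symmetric] even_card_sym_diff [OF fin]
        by (auto simp: mult.commute split: if_splits)
      then show ?thesis
        using True cl_sign_cases [of p A B] subspace_neg [OF S, of _ C] by auto
    next
      case False
      then show ?thesis
        using subspace_0 [OF S, of C] by simp
    qed
  qed
  then show ?thesis
    by (simp add: coeff_space_def Cl_mult even_mod)
qed

lemma subspace_Reals: "subspace (\<real> :: complex set)"
  by (rule subspaceI) (auto simp: scaleR_conv_of_real)

lemma subspace_imaginary: "subspace imaginary"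
  by (rule subspaceI) auto

lemma real_lie_algebra_wCl: "real_lie_algebra p q (wCl p q)"
proof -
  have "subspace (wCl p q)"
    unfolding wCl_eq_coeff_space
    by (intro subspace_coeff_space) (simp add: subspace_Reals subspace_imaginary)
  then show ?thesis
    by (simp add: real_lie_algebra_def cl_comm_wCl) (auto simp: wCl_def)
qed

text \<open>Closure under products gives closure under commutators, and intersecting with
  \<open>wCl p q\<close> preserves it. Each of the four cases then consists in a choice of
  \<open>E\<close> and \<open>D\<close>.\<close>

lemma lie_subalgebra_parity_space:
  fixes E D :: "complex set"
  assumes sub: "subspace E" "subspace D"
    and mult: "\<And>x y. x \<in> E \<Longrightarrow> y \<in> E \<Longrightarrow> x * y \<in> E"
      "\<And>x y. x \<in> E \<Longrightarrow> y \<in> D \<Longrightarrow> x * y \<in> D"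
      "\<And>x y. x \<in> D \<Longrightarrow> y \<in> D \<Longrightarrow> x * y \<in> E"
    and L: "L = wCl p q \<inter> coeff_space p q (\<lambda>j. if even j then E else D)"
  shows "lie_subalgebra p q L (wCl p q)"
proof -
  let ?M = "coeff_space p q (\<lambda>j. if even j then E else D)"
  have M: "subspace ?M"
    using sub by (intro subspace_coeff_space) simp
  have "cl_comm p q u v \<in> ?M" if "u \<in> ?M" "v \<in> ?M" for u v
    unfolding cl_comm_def
    by (rule subspace_diff [OF M]; rule cl_mult_parity_space [OF sub]) (fact mult that)+
  then have "real_lie_algebra p q L"
    using real_lie_algebra_wCl [of p q] M unfolding real_lie_algebra_def L
    by (auto intro: subspace_inter)
  then show ?thesis
    using real_lie_algebra_wCl L by (simp add: lie_subalgebra_def)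
qed

section \<open>The four subalgebras\<close>

lemma times_i_Reals: "(*) \<i> ` \<real> = imaginary"
proof (intro equalityI subsetI)
  fix z assume "z \<in> imaginary"
  then have "z = \<i> * of_real (Im z)"
    by (simp add: complex_eq_iff)
  then show "z \<in> (*) \<i> ` \<real>"
    by (rule image_eqI) simp
qed (auto simp: complex_is_Real_iff)

lemma Reals_Int_imaginary: "\<real> \<inter> imaginary = {0}"
  by (auto simp: complex_is_Real_iff complex_eq_iff)

lemma times_i_cl_qtype:
  "times_i (cl_qtype p q k) = coeff_space p q (\<lambda>j. if j = k mod 4 then imaginary else {0})"
  unfolding cl_qtype_eq_coeff_space times_i_coeff_space
  by (rule arg_cong [of _ _ "coeff_space p q"]) (auto simp: fun_eq_iff times_i_Reals)

text \<open>In rank 0 modulo 4 the elements of \<open>wCl p q\<close> have imaginary coefficients,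
  so among the real even elements only rank 2 modulo 4 survives.\<close>

lemma lie_subalgebra_cl_qtype_2: "lie_subalgebra p q (cl_qtype p q 2) (wCl p q)"
proof (rule lie_subalgebra_parity_space [OF subspace_Reals subspace_single_0])
  show "cl_qtype p q 2 = wCl p q \<inter> coeff_space p q (\<lambda>j. if even j then \<real> else {0})"
    unfolding cl_qtype_eq_coeff_space wCl_eq_coeff_space coeff_space_Int
    by (rule coeff_space_cong) (simp_all add: Reals_Int_imaginary Int_commute [of imaginary])
qed auto

text \<open>With all complex scalars allowed in even rank, the imaginary part in rank 0 modulo 4 is
  retained as well.\<close>

lemma lie_subalgebra_cl_qtype_2_i0:
  "lie_subalgebra p q (cl_qtype p q 2 \<oplus>\<^sub>S times_i (cl_qtype p q 0)) (wCl p q)"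
proof (rule lie_subalgebra_parity_space [OF subspace_UNIV subspace_single_0])
  show "cl_qtype p q 2 \<oplus>\<^sub>S times_i (cl_qtype p q 0) =
      wCl p q \<inter> coeff_space p q (\<lambda>j. if even j then UNIV else {0})"
    unfolding cl_qtype_eq_coeff_space [of _ _ 2] times_i_cl_qtype wCl_eq_coeff_space coeff_space_Int
    by (rule trans [OF subspace_sum_coeff_space coeff_space_cong])
       (simp_all add: Reals_Int_imaginary Int_commute [of imaginary] insert_absorb)
qed auto

text \<open>Products of two imaginary numbers are real, so imaginary odd coefficients are
  admissible. Rank 3 modulo 4 drops out, since there \<open>wCl p q\<close> is real.\<close>

lemma lie_subalgebra_cl_qtype_2_i1:
  "lie_subalgebra p q (cl_qtype p q 2 \<oplus>\<^sub>S times_i (cl_qtype p q 1)) (wCl p q)"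
proof (rule lie_subalgebra_parity_space [OF subspace_Reals subspace_imaginary])
  show "cl_qtype p q 2 \<oplus>\<^sub>S times_i (cl_qtype p q 1) =
      wCl p q \<inter> coeff_space p q (\<lambda>j. if even j then \<real> else imaginary)"
    unfolding cl_qtype_eq_coeff_space [of _ _ 2] times_i_cl_qtype wCl_eq_coeff_space coeff_space_Int
    by (rule trans [OF subspace_sum_coeff_space coeff_space_cong])
       (simp_all add: Reals_Int_imaginary Int_commute [of imaginary] insert_absorb)
qed (auto simp: complex_is_Real_iff)

text \<open>Real scalars in all ranks meet \<open>wCl p q\<close> trivially in ranks 0 and 1 modulo
  4 and fully in ranks 2 and 3.\<close>

lemma lie_subalgebra_cl_qtype_23:
  "lie_subalgebra p q (cl_qtype p q 2 \<oplus>\<^sub>S cl_qtype p q 3) (wCl p q)"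
proof (rule lie_subalgebra_parity_space [OF subspace_Reals subspace_Reals])
  show "cl_qtype p q 2 \<oplus>\<^sub>S cl_qtype p q 3 =
      wCl p q \<inter> coeff_space p q (\<lambda>j. if even j then \<real> else \<real>)"
    unfolding cl_qtype_eq_coeff_space wCl_eq_coeff_space coeff_space_Int
    by (rule trans [OF subspace_sum_coeff_space coeff_space_cong])
       (simp_all add: Reals_Int_imaginary Int_commute [of imaginary] insert_absorb)
qed auto

theorem theorem5:
  fixes p q :: nat
  assumes "p + q \<ge> 1"
  shows "group (WCl p q) \<and> lie_algebra_of p q (WCl p q) = wCl p q \<and>
    (\<forall>L \<in> {cl_qtype p q 2,
            cl_qtype p q 2 \<oplus>\<^sub>S times_i (cl_qtype p q 0),
            cl_qtype p q 2 \<oplus>\<^sub>S times_i (cl_qtype p q 1),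
            cl_qtype p q 2 \<oplus>\<^sub>S cl_qtype p q 3}.
       (\<forall>U\<in>L. \<forall>V\<in>L. cl_comm p q U V \<in> L) \<and> lie_subalgebra p q L (wCl p q))"
proof -
  have "\<forall>U\<in>L. \<forall>V\<in>L. cl_comm p q U V \<in> L" if "lie_subalgebra p q L (wCl p q)" for L
    using that by (simp add: lie_subalgebra_def real_lie_algebra_def)
  then show ?thesis
    using group_WCl lie_algebra_of_WCl lie_subalgebra_cl_qtype_2 lie_subalgebra_cl_qtype_2_i0
      lie_subalgebra_cl_qtype_2_i1 lie_subalgebra_cl_qtype_23 by simp
qed

end
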